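(* Let $n\ge1$ be an integer. For all integers $p,q\ge1$ and all real $s>-n-1$, $$c_{pq}(s)=\frac{\Gamma(s+n+1)\,\Gamma(s+1+2n)}{\Gamma(n)^3\,\Gamma(2s+2n+2)}\,(p)_n(q)_n\int_0^1\!\int_0^1x^{p-1}y^{q-1}(1-x)^{n+s}(1-y)^{n+s}\,{}_2F_1(s+1,n+s+1;2n+2s+2;1-xy)\,dx\,dy.$$
   Context: Notation: $(\nu)_k=\nu(\nu+1)\cdots(\nu+k-1)$, ${}_2F_1$ is the Gauss hypergeometric function. For integers $p,q\ge0$, $$S_{pq}(t)=\frac{{}_2F_1(p,q;p+q+n;t)}{{}_2F_1(p,q;p+q+n;1)}=\frac{(n)_p(n)_q}{(n)_{p+q}}\,{}_2F_1(p,q;p+q+n;t),$$ and for $s>-1$ $$c_{pq}(s)=\frac{(s+1)_n}{\Gamma(n)}\int_0^1t^{p+q+n-1}(1-t)^sS_{pq}(t)^2\,dt.$$ For each $p,q$, the function $c_{pq}$ extends holomorphically to the half-plane $\operatorname{Re}s>-n-1$, and for $-n-1<s\le-1$ the symbol $c_{pq}(s)$ denotes the value of this analytic continuation. *)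

theory Defs
  imports "HOL-Complex_Analysis.Complex_Analysis"
begin

(* The sum of the Gauss series; it is only used for 0 < t < 1, and at t = 1 with c - a - b > 0,
   where the series converges. *)
definition hyp2F1 :: "real \<Rightarrow> real \<Rightarrow> real \<Rightarrow> real \<Rightarrow> real" where
  "hyp2F1 a b c t = eval_fps (fps_hypergeo [a, b] [c] 1) t"

lemma hyp2F1_eq_suminf:
  "hyp2F1 a b c t = (\<Sum>k. pochhammer a k * pochhammer b k / (pochhammer c k * fact k) * t ^ k)"
  by (simp add: hyp2F1_def eval_fps_def)

definition S_fun :: "nat \<Rightarrow> nat \<Rightarrow> nat \<Rightarrow> real \<Rightarrow> real" where
  "S_fun n p q t =
     hyp2F1 (real p) (real q) (real (p + q + n)) t / hyp2F1 (real p) (real q) (real (p + q + n)) 1"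

definition c_integral :: "nat \<Rightarrow> nat \<Rightarrow> nat \<Rightarrow> real \<Rightarrow> real" where
  "c_integral n p q s =
     pochhammer (s + 1) n / Gamma (real n) *
     (LBINT t=0..1. t ^ (p + q + n - 1) * (1 - t) powr s * (S_fun n p q t)\<^sup>2)"

definition c_extension :: "nat \<Rightarrow> nat \<Rightarrow> nat \<Rightarrow> (complex \<Rightarrow> complex) \<Rightarrow> bool" where
  "c_extension n p q f \<longleftrightarrow>
     f holomorphic_on {z. Re z > - real n - 1} \<and>
     (\<forall>s>-1. f (complex_of_real s) = complex_of_real (c_integral n p q s))"

(* An extension is unique on the half-plane, so the choice below only matters outside it. *)
lemma c_extension_unique:
  assumes f: "c_extension n p q f" and g: "c_extension n p q g" and z: "Re z > - real n - 1"
  shows "f z = g z"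
proof -
  let ?S = "{z. Re z > - real n - 1}"
  let ?U = "complex_of_real ` {-1<..}"
  have "0 islimpt ?U"
    unfolding islimpt_approachable
  proof (intro allI impI)
    fix e :: real assume e: "e > 0"
    then have "complex_of_real (e / 2) \<in> ?U"
      by (intro imageI) simp
    with e show "\<exists>x'\<in>?U. x' \<noteq> 0 \<and> dist x' 0 < e"
      by (intro bexI[of _ "complex_of_real (e / 2)"]) auto
  qed
  moreover have "(\<lambda>z. f z - g z) holomorphic_on ?S"
    using f g by (auto simp: c_extension_def intro!: holomorphic_intros)
  moreover have "f u - g u = 0" if "u \<in> ?U" for u
    using that f g by (auto simp: c_extension_def)
  ultimately have "f z - g z = 0"
    using z by (intro analytic_continuation[of "\<lambda>z. f z - g z" ?S ?U 0 z])
      (auto simp: open_halfspace_Re_gt intro!: convex_connected convex_halfspace_Re_gt)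
  then show ?thesis by simp
qed

definition c_fun :: "nat \<Rightarrow> nat \<Rightarrow> nat \<Rightarrow> complex \<Rightarrow> complex" where
  "c_fun n p q = (SOME f. c_extension n p q f)"

end

theory Submission
  imports Defs
begin

text \<open>
  For \<open>s > -1\<close> both sides are the same triple integral in different coordinates.
  Euler's formula \<open>B(b, c - b) F(a, b; c; z) = \<integral> w^(b-1) (1-w)^(c-b-1) (1-zw)^(-a) dw\<close>
  (lemma \<open>Euler_integral_hyp2F1\<close>), applied once with \<open>(a,b) = (q,p)\<close> and once with \<open>(p,q)\<close>, turns
  \<open>S_pq(t)^2\<close> into a double integral over \<open>(u,v)\<close>; Gauss's value of the series at \<open>1\<close> supplies the
  constant \<open>(p)_n (q)_n / \<Gamma>(n)^2\<close>. On the other side, Euler's formula with \<open>b = s + 1\<close>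
  turns the hypergeometric factor into an integral over \<open>w\<close>, and all Gamma factors cancel except
  \<open>(s+1)_n / \<Gamma>(n)^3\<close>. The two triple integrals are exchanged by
  \<open>x = u(1-w)/(1-uw)\<close>, \<open>y = v(1-w)/(1-vw)\<close>, \<open>t = (1-w)/(1-kw)\<close>, where \<open>k = u + v - uv\<close>.
  Each of \<open>x\<close>, \<open>y\<close> and \<open>1-t\<close> arises from a single variable, the other two being held fixed, by a
  Moebius map \<open>z \<mapsto> z(1-m)/(1-mz)\<close> of the unit interval, with \<open>m = w\<close> for \<open>x\<close> and \<open>y\<close> and
  \<open>m = k\<close> for \<open>1-t\<close>. So no multidimensional change of variables is involved, only
  Tonelli's theorem and one-dimensional substitutions
  (\<open>nn_integral_S_kernel_eq_euler_kernel\<close>).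

  For the continuation, the two numerator parameters of \<open>F(s+1, n+s+1; 2n+2s+2; z)\<close> switch roles:
  Euler's formula is used with \<open>a = s + 1\<close> and \<open>b = n + s + 1\<close>. This is legitimate on the whole range
  \<open>s > -n-1\<close>, and the integrand is now \<open>g \<cdot> exp(sL)\<close> with \<open>g \<ge> 0\<close> and \<open>L \<le> 0\<close> independent of \<open>s\<close>.
  Such an integral is holomorphic in every open right half-plane in which it converges absolutely
  (\<open>holomorphic_exp_integral\<close>), and the remaining Gamma quotient is the polynomial
  \<open>(s+n+1)_n\<close>. Hence the right-hand side is the restriction to the real axis of a holomorphic
  function on the half-plane, which by the first part extends \<open>c_pq\<close>; uniqueness of the extension
  gives the claim.
\<close>

section \<open>Lebesgue measure on the open unit interval and its powers\<close>

text \<open>A measure whose space is the open interval itself: congruence rules for integrals then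
  supply \<open>0 < x < 1\<close>, so no integrand has to be discussed at the end points.\<close>
definition unit_lborel :: "real measure" where
  "unit_lborel = restrict_space lborel {0<..<1}"

lemma space_unit_lborel [simp]: "space unit_lborel = {0<..<1}"
  by (simp add: unit_lborel_def space_restrict_space)

lemma measurable_unit_lborelI:
  "f \<in> borel_measurable borel \<Longrightarrow> f \<in> borel_measurable unit_lborel"
  by (simp add: unit_lborel_def measurable_restrict_space1)

lemma ident_borel_measurable_unit_lborel: "(\<lambda>x. x) \<in> unit_lborel \<rightarrow>\<^sub>M borel"
  by (rule measurable_unit_lborelI) simp

lemma measurable_unit_lborel_pairI:
  assumes f: "f \<in> borel_measurable (borel \<Otimes>\<^sub>M borel)"
  shows "f \<in> borel_measurable (unit_lborel \<Otimes>\<^sub>M unit_lborel)"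
proof -
  note id = ident_borel_measurable_unit_lborel
  have "(\<lambda>x. (fst x, snd x)) \<in> unit_lborel \<Otimes>\<^sub>M unit_lborel \<rightarrow>\<^sub>M borel \<Otimes>\<^sub>M borel"
    by (intro measurable_Pair measurable_compose[OF _ id] measurable_fst measurable_snd)
  from measurable_compose[OF this f] show ?thesis by simp
qed

lemma measurable_unit_lborel_tripleI:
  assumes f: "f \<in> borel_measurable (borel \<Otimes>\<^sub>M borel \<Otimes>\<^sub>M borel)"
  shows "f \<in> borel_measurable (unit_lborel \<Otimes>\<^sub>M unit_lborel \<Otimes>\<^sub>M unit_lborel)"
proof -
  note id = ident_borel_measurable_unit_lborel
  have "(\<lambda>x. (fst x, fst (snd x), snd (snd x)))
      \<in> unit_lborel \<Otimes>\<^sub>M unit_lborel \<Otimes>\<^sub>M unit_lborel \<rightarrow>\<^sub>M borel \<Otimes>\<^sub>M borel \<Otimes>\<^sub>M borel"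
    by (intro measurable_Pair measurable_compose[OF _ id] measurable_fst
        measurable_compose[OF measurable_snd measurable_fst]
        measurable_compose[OF measurable_snd measurable_snd])
  from measurable_compose[OF this f] show ?thesis by simp
qed

lemma sigma_finite_unit_lborel: "sigma_finite_measure unit_lborel"
  unfolding unit_lborel_def
  by (rule sigma_finite_measure_restrict_space) (auto intro: lborel.sigma_finite_measure_axioms)

interpretation unit_lborel: sigma_finite_measure unit_lborel
  by (rule sigma_finite_unit_lborel)

interpretation unit_lborel_pair: pair_sigma_finite unit_lborel unit_lborel ..

lemma nn_integral_unit_lborel:
  "(\<integral>\<^sup>+x. f x \<partial>unit_lborel) = (\<integral>\<^sup>+x. f x * indicator {0<..<1} x \<partial>lborel)"
  by (simp add: unit_lborel_def nn_integral_restrict_space)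

lemma LBINT_eq_unit_lborel: "(LBINT x=0..1. f x) = (LINT x|unit_lborel. f x)"
proof -
  have "einterval 0 1 = {0<..<1}"
    by (auto simp: einterval_def zero_ereal_def one_ereal_def)
  then show ?thesis
    by (simp add: interval_lebesgue_integral_def set_lebesgue_integral_def unit_lborel_def
        integral_restrict_space)
qed

interpretation unit_lborel_triple: pair_sigma_finite unit_lborel "unit_lborel \<Otimes>\<^sub>M unit_lborel" ..

lemma nn_integral_unit_lborel_triple:
  assumes "(\<lambda>(x, y, z). f x y z) \<in> borel_measurable (borel \<Otimes>\<^sub>M borel \<Otimes>\<^sub>M borel)"
  shows "(\<integral>\<^sup>+x. \<integral>\<^sup>+y. \<integral>\<^sup>+z. f x y z \<partial>unit_lborel \<partial>unit_lborel \<partial>unit_lborel) =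
    (\<integral>\<^sup>+(x, y, z). f x y z \<partial>(unit_lborel \<Otimes>\<^sub>M unit_lborel \<Otimes>\<^sub>M unit_lborel))"
proof -
  note m = measurable_unit_lborel_tripleI[OF assms]
  have "(\<lambda>(y, z). f x y z) \<in> borel_measurable (unit_lborel \<Otimes>\<^sub>M unit_lborel)" for x
    by (rule measurable_unit_lborel_pairI)
      (use measurable_compose[OF measurable_Pair1' assms, of x] in simp)
  then have "(\<integral>\<^sup>+x. \<integral>\<^sup>+y. \<integral>\<^sup>+z. f x y z \<partial>unit_lborel \<partial>unit_lborel \<partial>unit_lborel) =
    (\<integral>\<^sup>+x. \<integral>\<^sup>+p. (case p of (y, z) \<Rightarrow> f x y z) \<partial>(unit_lborel \<Otimes>\<^sub>M unit_lborel) \<partial>unit_lborel)"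
    by (simp add: unit_lborel.nn_integral_fst[symmetric])
  also have "\<dots> = (\<integral>\<^sup>+(x, y, z). f x y z \<partial>(unit_lborel \<Otimes>\<^sub>M unit_lborel \<Otimes>\<^sub>M unit_lborel))"
    using unit_lborel_pair.nn_integral_fst[OF m] by simp
  finally show ?thesis .
qed

text \<open>Tonelli's theorem for iterated integrals, in the form needed to bring any of three variables
  into the innermost position.\<close>
lemma nn_integral_unit_lborel_rotate:
  assumes "(\<lambda>(x, y, z). f x y z) \<in> borel_measurable (borel \<Otimes>\<^sub>M borel \<Otimes>\<^sub>M borel)"
  shows "(\<integral>\<^sup>+x. \<integral>\<^sup>+y. \<integral>\<^sup>+z. f x y z \<partial>unit_lborel \<partial>unit_lborel \<partial>unit_lborel) =
    (\<integral>\<^sup>+z. \<integral>\<^sup>+x. \<integral>\<^sup>+y. f x y z \<partial>unit_lborel \<partial>unit_lborel \<partial>unit_lborel)"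
proof -
  have f: "(\<lambda>(y, z). f x y z) \<in> borel_measurable (unit_lborel \<Otimes>\<^sub>M unit_lborel)" for x
    by (rule measurable_unit_lborel_pairI)
      (use measurable_compose[OF measurable_Pair1' assms, of x] in simp)
  have "(\<integral>\<^sup>+x. \<integral>\<^sup>+y. \<integral>\<^sup>+z. f x y z \<partial>unit_lborel \<partial>unit_lborel \<partial>unit_lborel) =
     (\<integral>\<^sup>+x. \<integral>\<^sup>+z. \<integral>\<^sup>+y. f x y z \<partial>unit_lborel \<partial>unit_lborel \<partial>unit_lborel)"
    using unit_lborel_pair.Fubini[OF f] by simp
  also have "\<dots> = (\<integral>\<^sup>+z. \<integral>\<^sup>+x. \<integral>\<^sup>+y. f x y z \<partial>unit_lborel \<partial>unit_lborel \<partial>unit_lborel)"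
  proof -
    have "(\<lambda>(p, y). f (fst p) y (snd p)) \<in> borel_measurable ((unit_lborel \<Otimes>\<^sub>M unit_lborel) \<Otimes>\<^sub>M unit_lborel)"
    proof -
      have "(\<lambda>q. (fst (fst q), snd q, snd (fst q))) \<in>
        (unit_lborel \<Otimes>\<^sub>M unit_lborel) \<Otimes>\<^sub>M unit_lborel \<rightarrow>\<^sub>M unit_lborel \<Otimes>\<^sub>M unit_lborel \<Otimes>\<^sub>M unit_lborel"
        by measurable
      from measurable_compose[OF this measurable_unit_lborel_tripleI[OF assms]] show ?thesis
        by (simp add: case_prod_beta)
    qed
    then have "(\<lambda>p. \<integral>\<^sup>+y. f (fst p) y (snd p) \<partial>unit_lborel) \<in> borel_measurable (unit_lborel \<Otimes>\<^sub>M unit_lborel)"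
      by (intro unit_lborel.borel_measurable_nn_integral) (simp add: case_prod_beta)
    from unit_lborel_pair.Fubini[OF this] show ?thesis by simp
  qed
  finally show ?thesis .
qed

lemma nn_integral_unit_lborel_reflect:
  assumes "f \<in> borel_measurable borel"
  shows "(\<integral>\<^sup>+t. f t \<partial>unit_lborel) = (\<integral>\<^sup>+t. f (1 - t) \<partial>unit_lborel)"
proof -
  have "(\<integral>\<^sup>+t. f t \<partial>unit_lborel) = (\<integral>\<^sup>+t. f (1 + (-1) * t) * indicator {0<..<1} (1 + (-1) * t) \<partial>lborel)"
    unfolding nn_integral_unit_lborel using assms
    by (subst nn_integral_real_affine[where c = "-1" and t = 1]) auto
  also have "\<dots> = (\<integral>\<^sup>+t. f (1 - t) \<partial>unit_lborel)"
    unfolding nn_integral_unit_lborel by (intro nn_integral_cong) (auto simp: indicator_def)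
  finally show ?thesis .
qed

lemma LINT_unit_lborel_triple:
  fixes f :: "real \<Rightarrow> real \<Rightarrow> real \<Rightarrow> real"
  assumes int: "integrable (unit_lborel \<Otimes>\<^sub>M unit_lborel \<Otimes>\<^sub>M unit_lborel) (\<lambda>(x, y, z). f x y z)"
  and m: "(\<lambda>(x, y, z). f x y z) \<in> borel_measurable (borel \<Otimes>\<^sub>M borel \<Otimes>\<^sub>M borel)"
  shows "(LINT x|unit_lborel. LINT y|unit_lborel. LINT z|unit_lborel. f x y z) =
     (LINT (x, y, z)|(unit_lborel \<Otimes>\<^sub>M unit_lborel \<Otimes>\<^sub>M unit_lborel). f x y z)"
proof -
  have "(LINT x|unit_lborel. LINT y|unit_lborel. LINT z|unit_lborel. f x y z) =
    (LINT x|unit_lborel. LINT p|(unit_lborel \<Otimes>\<^sub>M unit_lborel). (case p of (y, z) \<Rightarrow> f x y z))"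
  proof (rule integral_cong_AE)
    have m': "(\<lambda>(q, z). f (fst q) (snd q) z) \<in> borel_measurable ((unit_lborel \<Otimes>\<^sub>M unit_lborel) \<Otimes>\<^sub>M unit_lborel)"
    proof -
      have "(\<lambda>q. (fst (fst q), snd (fst q), snd q)) \<in>
        (unit_lborel \<Otimes>\<^sub>M unit_lborel) \<Otimes>\<^sub>M unit_lborel \<rightarrow>\<^sub>M unit_lborel \<Otimes>\<^sub>M unit_lborel \<Otimes>\<^sub>M unit_lborel"
        by measurable
      from measurable_compose[OF this measurable_unit_lborel_tripleI[OF m]] show ?thesis
        by (simp add: case_prod_beta)
    qed
    have "(\<lambda>q. LINT z|unit_lborel. f (fst q) (snd q) z) \<in> borel_measurable (unit_lborel \<Otimes>\<^sub>M unit_lborel)"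
      by (rule unit_lborel.borel_measurable_lebesgue_integral) (use m' in simp)
    then show "(\<lambda>x. LINT y|unit_lborel. LINT z|unit_lborel. f x y z) \<in> borel_measurable unit_lborel"
      by (intro unit_lborel.borel_measurable_lebesgue_integral) (simp add: case_prod_beta)
    show "(\<lambda>x. LINT p|(unit_lborel \<Otimes>\<^sub>M unit_lborel). (case p of (y, z) \<Rightarrow> f x y z)) \<in> borel_measurable unit_lborel"
      by (intro unit_lborel_pair.borel_measurable_lebesgue_integral)
        (use measurable_unit_lborel_tripleI[OF m] in \<open>simp add: case_prod_unfold\<close>)
    have "AE x in unit_lborel. integrable (unit_lborel \<Otimes>\<^sub>M unit_lborel) (\<lambda>p. case (x, p) of (x, y, z) \<Rightarrow> f x y z)"
      by (rule unit_lborel_triple.AE_integrable_fst'[OF int])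
    then show "AE x in unit_lborel. (LINT y|unit_lborel. LINT z|unit_lborel. f x y z) =
      (LINT p|(unit_lborel \<Otimes>\<^sub>M unit_lborel). (case p of (y, z) \<Rightarrow> f x y z))"
      by eventually_elim (simp add: unit_lborel_pair.integral_fst' [symmetric])
  qed
  also have "\<dots> = (LINT (x, y, z)|(unit_lborel \<Otimes>\<^sub>M unit_lborel \<Otimes>\<^sub>M unit_lborel). f x y z)"
    using unit_lborel_triple.integral_fst'[OF int] by simp
  finally show ?thesis .
qed

section \<open>Euler's integral and the value of the Gauss series at one\<close>

lemma has_bochner_integral_Beta:
  assumes "a > 0" "b > 0"
  shows "has_bochner_integral unit_lborel (\<lambda>t. t powr (a - 1) * (1 - t) powr (b - 1)) (Beta a b)"
proof -
  have I: "set_integrable lborel {0..1} (\<lambda>t. t powr (a - 1) * (1 - t) powr (b - 1))"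
    using integrable_Beta assms by auto
  have J: "set_lebesgue_integral lborel {0..1} (\<lambda>t. t powr (a - 1) * (1 - t) powr (b - 1)) = Beta a b"
    using set_borel_integral_eq_integral(2)[OF I] has_integral_Beta_real[OF assms]
    by (simp add: integral_unique)
  have eq: "AE t in lborel. indicator {0..1} t *\<^sub>R (t powr (a - 1) * (1 - t) powr (b - 1))
    = indicator {0<..<1} t *\<^sub>R (t powr (a - 1) * (1 - t) powr (b - 1))"
    by (rule AE_I2) (auto simp: indicator_def)
  have I': "set_integrable lborel {0<..<1} (\<lambda>t. t powr (a - 1) * (1 - t) powr (b - 1))"
    using I by (rule set_integrable_subset) auto
  moreover have "set_lebesgue_integral lborel {0<..<1} (\<lambda>t. t powr (a - 1) * (1 - t) powr (b - 1)) = Beta a b"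
    unfolding J[symmetric] set_lebesgue_integral_def
    by (intro Bochner_Integration.integral_cong) (auto simp: indicator_def)
  ultimately show ?thesis
    by (simp add: has_bochner_integral_iff unit_lborel_def integral_restrict_space
        integrable_restrict_space set_lebesgue_integral_def set_integrable_def)
qed

lemma Beta_pochhammer:
  assumes "b > 0" "c > b"
  shows "Beta (b + real k) (c - b) = Beta b (c - b) * pochhammer b k / pochhammer c k"
proof -
  have "b \<notin> \<int>\<^sub>\<le>\<^sub>0" "c \<notin> \<int>\<^sub>\<le>\<^sub>0"
    using assms by (auto dest: nonpos_Ints_nonpos)
  then have "pochhammer b k = Gamma (b + real k) / Gamma b" "pochhammer c k = Gamma (c + real k) / Gamma c"
    by (simp_all add: pochhammer_Gamma)
  moreover have "Gamma b > 0" "Gamma c > 0" "Gamma (c + real k) > 0" using assms by auto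
  ultimately show ?thesis by (simp add: Beta_def field_simps)
qed

text \<open>The binomial series with exponent \<open>-a\<close>, whose coefficients are those of the Gauss series without
  the factor \<open>(b)_k / (c)_k\<close>.\<close>
lemma pochhammer_binomial_sums:
  fixes z a :: real
  assumes "\<bar>z\<bar> < 1"
  shows "(\<lambda>k. pochhammer a k / fact k * z ^ k) sums (1 - z) powr (-a)"
proof -
  have "(\<lambda>k. ((-a) gchoose k) * (-z) ^ k) sums (1 + (-z)) powr (-a)"
    using assms by (intro gen_binomial_real) simp
  moreover have "((-a) gchoose k) * (-z) ^ k = pochhammer a k / fact k * z ^ k" for k
  proof -
    have "(-1) ^ k * (-z) ^ k = z ^ k" by (simp flip: power_mult_distrib)
    then show ?thesis by (simp add: gbinomial_pochhammer mult.left_commute mult.commute)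
  qed
  ultimately show ?thesis by simp
qed

lemma summable_abs_pochhammer_binomial:
  fixes z a :: real
  assumes "0 \<le> z" "z < 1"
  shows "summable (\<lambda>k. \<bar>pochhammer a k\<bar> / fact k * z ^ k)"
proof -
  have "ereal (norm z) < conv_radius (\<lambda>k. pochhammer a k / fact k)"
  proof -
    have "1 \<le> conv_radius (\<lambda>k. pochhammer a k / fact k)"
    proof (rule conv_radius_geI_ex)
      fix r :: real assume "0 < r" "ereal r < 1"
      then have "\<bar>r\<bar> < 1" by auto
      from sums_summable[OF pochhammer_binomial_sums[OF this]] \<open>0 < r\<close>
      show "\<exists>z. norm z = r \<and> summable (\<lambda>k. pochhammer a k / fact k * z ^ k)"
        by (intro exI[of _ r]) auto
    qed
    then show ?thesis using assms by (metis abs_of_nonneg ereal_less(3) less_le_trans real_norm_def)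
  qed
  from abs_summable_in_conv_radius[OF this] show ?thesis
    using assms by (simp add: norm_mult norm_power abs_mult)
qed

text \<open>Expand \<open>(1 - zw)^(-a)\<close> in its binomial series and integrate term by term: the
  \<open>k\<close>-th term is the Beta integral \<open>B(b+k, c-b) = B(b, c-b) (b)_k / (c)_k\<close>. The interchange is
  justified by absolute summability of the Gauss series, so that \<open>z = 1\<close> and negative \<open>a\<close> (where
  the terms change sign) are both covered.\<close>
lemma Euler_integral_hyp2F1_if_summable:
  assumes b: "b > 0" and c: "c > b" and z: "0 \<le> z" "z \<le> 1"
    and sm: "summable (\<lambda>k. \<bar>pochhammer a k\<bar> * pochhammer b k / (pochhammer c k * fact k) * z ^ k)"
  shows "has_bochner_integral unit_lborel
           (\<lambda>w. w powr (b - 1) * (1 - w) powr (c - b - 1) * (1 - z * w) powr (-a))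
           (Beta b (c - b) * hyp2F1 a b c z)"
proof -
  define g where "g = (\<lambda>w. w powr (b - 1) * (1 - w) powr (c - b - 1))"
  define t where "t = (\<lambda>k. pochhammer a k / fact k * z ^ k)"
  define f where "f = (\<lambda>k w. g w * (t k * w ^ k))"
  have g_eq: "g w * w ^ k = w powr (b + real k - 1) * (1 - w) powr (c - b - 1)" if "w \<in> {0<..<1}" for k w
    using that by (simp add: g_def powr_add powr_diff powr_realpow)
  have fi: "has_bochner_integral unit_lborel (f k) (t k * Beta (b + real k) (c - b))" for k
  proof -
    have "has_bochner_integral unit_lborel (\<lambda>w. t k * (w powr (b + real k - 1) * (1 - w) powr (c - b - 1)))
       (t k * Beta (b + real k) (c - b))"
      using b c by (intro has_bochner_integral_mult_right has_bochner_integral_Beta) auto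
    then show ?thesis
      by (rule has_bochner_integral_cong[THEN iffD1, rotated -1]) (auto simp: f_def simp flip: g_eq)
  qed
  have fn: "integral\<^sup>L unit_lborel (\<lambda>w. norm (f k w)) = \<bar>t k\<bar> * Beta (b + real k) (c - b)" for k
  proof -
    have "has_bochner_integral unit_lborel (\<lambda>w. \<bar>t k\<bar> * (w powr (b + real k - 1) * (1 - w) powr (c - b - 1)))
       (\<bar>t k\<bar> * Beta (b + real k) (c - b))"
      using b c by (intro has_bochner_integral_mult_right has_bochner_integral_Beta) auto
    moreover have "\<bar>t k\<bar> * (w powr (b + real k - 1) * (1 - w) powr (c - b - 1)) = norm (f k w)"
      if "w \<in> {0<..<1}" for w
      using that by (simp add: f_def abs_mult g_def flip: g_eq)
    ultimately have "has_bochner_integral unit_lborel (\<lambda>w. norm (f k w)) (\<bar>t k\<bar> * Beta (b + real k) (c - b))"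
      by (subst has_bochner_integral_cong[OF refl _ refl]) auto
    then show ?thesis
      by (rule has_bochner_integral_integral_eq)
  qed
  have pos: "pochhammer c k > 0" "pochhammer b k > 0" for k
    using b c by (auto intro!: pochhammer_pos)
  have B_eq: "\<bar>t k\<bar> * Beta (b + real k) (c - b) =
    Beta b (c - b) * (\<bar>pochhammer a k\<bar> * pochhammer b k / (pochhammer c k * fact k) * z ^ k)" for k
    using z by (simp add: Beta_pochhammer[OF b c] t_def abs_mult mult_ac)
  have sums: "(\<lambda>k. f k w) sums (g w * (1 - z * w) powr (-a))" if w: "w \<in> {0<..<1}" for w
  proof -
    have "z * w \<le> 1 * w" "0 \<le> z * w" "w < 1" using w z by (auto intro: mult_right_mono)
    then have zw: "0 \<le> z * w" "z * w < 1" by linarith+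
    then have "(\<lambda>k. pochhammer a k / fact k * (z * w) ^ k) sums (1 - z * w) powr (-a)"
      using zw by (intro pochhammer_binomial_sums) auto
    then show ?thesis
      unfolding f_def t_def by (intro sums_mult) (simp add: power_mult_distrib mult_ac)
  qed
  have sumnorm: "summable (\<lambda>k. norm (f k w))" if w: "w \<in> {0<..<1}" for w
  proof -
    have "z * w \<le> 1 * w" "0 \<le> z * w" "w < 1" using w z by (auto intro: mult_right_mono)
    then have zw: "0 \<le> z * w" "z * w < 1" by linarith+
    from summable_abs_pochhammer_binomial[OF zw, of a]
    have "summable (\<lambda>k. \<bar>g w\<bar> * (\<bar>pochhammer a k\<bar> / fact k * (z * w) ^ k))"
      by (rule summable_mult)
    then show ?thesis using w z
      by (simp add: f_def t_def abs_mult power_abs power_mult_distrib mult_ac)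
  qed
  have I: "integrable unit_lborel (f k)" for k
    using fi[of k] by (simp add: has_bochner_integral_iff)
  have AE: "AE w in unit_lborel. summable (\<lambda>k. norm (f k w))"
    using sumnorm by (intro AE_I2) simp
  have S: "summable (\<lambda>k. integral\<^sup>L unit_lborel (\<lambda>w. norm (f k w)))"
    unfolding fn B_eq by (intro summable_mult sm)
  have cong: "(\<Sum>k. f k w) = g w * (1 - z * w) powr (-a)" if "w \<in> {0<..<1}" for w
    using sums[OF that] by (simp add: sums_iff)
  have val: "(\<Sum>k. t k * Beta (b + real k) (c - b)) = Beta b (c - b) * hyp2F1 a b c z"
  proof -
    have "summable (\<lambda>k. pochhammer a k * pochhammer b k / (pochhammer c k * fact k) * z ^ k)"
      using sm pos z by (intro summable_norm_cancel[OF summable_cong[THEN iffD1, OF _ sm]])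
        (auto simp: abs_mult less_imp_le intro!: always_eventually)
    then show ?thesis
      unfolding hyp2F1_eq_suminf by (subst suminf_mult[symmetric])
        (auto simp: Beta_pochhammer[OF b c] t_def mult_ac)
  qed
  have "has_bochner_integral unit_lborel (\<lambda>w. \<Sum>k. f k w) (Beta b (c - b) * hyp2F1 a b c z)"
    using integrable_suminf[OF I AE S] integral_suminf[OF I AE S] fi val
    by (simp add: has_bochner_integral_iff)
  then show ?thesis
    by (rule has_bochner_integral_cong[THEN iffD1, rotated -1]) (auto simp: cong g_def)
qed

lemma Euler_integral_hyp2F1:
  assumes b: "b > 0" and c: "c > b" and z: "0 \<le> z" "z < 1"
  shows "has_bochner_integral unit_lborel
           (\<lambda>w. w powr (b - 1) * (1 - w) powr (c - b - 1) * (1 - z * w) powr (-a))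
           (Beta b (c - b) * hyp2F1 a b c z)"
proof (rule Euler_integral_hyp2F1_if_summable)
  have pos: "pochhammer c k > 0" "pochhammer b k > 0" for k
    using b c by (auto intro!: pochhammer_pos)
  have le: "pochhammer b k \<le> pochhammer c k" for k
    unfolding pochhammer_prod using b c by (intro prod_mono) auto
  show "summable (\<lambda>k. \<bar>pochhammer a k\<bar> * pochhammer b k / (pochhammer c k * fact k) * z ^ k)"
  proof (rule summable_comparison_test_ev[OF always_eventually summable_abs_pochhammer_binomial[OF z, of a]], rule allI)
    fix k
    have "\<bar>pochhammer a k\<bar> / fact k * z ^ k * (pochhammer b k / pochhammer c k) \<le> \<bar>pochhammer a k\<bar> / fact k * z ^ k * 1"
      using pos le z by (intro mult_left_mono) auto
    then show "norm (\<bar>pochhammer a k\<bar> * pochhammer b k / (pochhammer c k * fact k) * z ^ k) \<le> \<bar>pochhammer a k\<bar> / fact k * z ^ k"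
      using pos[of k] z by (simp add: abs_mult less_imp_le mult_ac)
  qed
qed (use assms in auto)

text \<open>Gauss's summation theorem is Euler's integral at \<open>z = 1\<close>, which is again a Beta integral.
  Since all terms are nonnegative, this Beta integral also bounds the partial sums and so gives the
  required convergence.\<close>
lemma Gauss_hyp2F1_1:
  assumes a: "a \<ge> 0" and b: "b > 0" and c: "c > a + b"
  shows "Beta b (c - b) * hyp2F1 a b c 1 = Beta b (c - a - b)"
proof -
  have c': "c > b" using a c by simp
  have pos: "pochhammer c k > 0" "pochhammer b k > 0" "pochhammer a k \<ge> 0" for k
    using a b c by (auto intro!: pochhammer_pos prod_nonneg simp: pochhammer_prod[of a])
  have B: "Beta b (c - b) > 0" using b c' by (simp add: Beta_def)
  have bd: "has_bochner_integral unit_lborel (\<lambda>w. w powr (b - 1) * (1 - w) powr (c - a - b - 1)) (Beta b (c - a - b))"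
    using b c by (intro has_bochner_integral_Beta) auto
  \<comment> \<open>The binomial partial sums stay below \<open>(1 - w)^(-a)\<close>, whose weighted integral is
    \<open>B(b, c - a - b)\<close>.\<close>
  have "summable (\<lambda>k. \<bar>pochhammer a k\<bar> * pochhammer b k / (pochhammer c k * fact k) * 1 ^ k)"
  proof (rule bounded_imp_summable[where B = "Beta b (c - a - b) / Beta b (c - b)"])
    fix N
    have "(\<Sum>k\<le>N. pochhammer a k / fact k * Beta (b + real k) (c - b)) \<le> Beta b (c - a - b)"
    proof -
      have bs: "has_bochner_integral unit_lborel (\<lambda>w. \<Sum>k\<le>N. pochhammer a k / fact k *
          (w powr (b + real k - 1) * (1 - w) powr (c - b - 1))) (\<Sum>k\<le>N. pochhammer a k / fact k * Beta (b + real k) (c - b))"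
        using b c' by (intro has_bochner_integral_sum has_bochner_integral_mult_right has_bochner_integral_Beta) auto
      have "(LINT w|unit_lborel. (\<Sum>k\<le>N. pochhammer a k / fact k *
          (w powr (b + real k - 1) * (1 - w) powr (c - b - 1)))) \<le>
        (LINT w|unit_lborel. w powr (b - 1) * (1 - w) powr (c - a - b - 1))"
      proof (rule integral_mono)
        fix w assume "w \<in> space unit_lborel"
        then have w: "0 < w" "w < 1" by auto
        have pw1: "w powr (b + real k - 1) = w powr (b - 1) * w ^ k" for k
          using w by (simp add: powr_realpow[symmetric] flip: powr_add) (simp add: algebra_simps)
        have pw2: "(1 - w) powr (c - a - b - 1) = (1 - w) powr (c - b - 1) * (1 - w) powr (-a)"
          by (simp flip: powr_add) (simp add: algebra_simps)
        have "(\<Sum>k\<le>N. pochhammer a k / fact k * w ^ k) \<le> (1 - w) powr (-a)"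
        proof -
          have "(\<lambda>k. pochhammer a k / fact k * w ^ k) sums (1 - w) powr (-a)"
            using w by (intro pochhammer_binomial_sums) auto
          moreover from this have "(\<Sum>k\<le>N. pochhammer a k / fact k * w ^ k) \<le> (\<Sum>k. pochhammer a k / fact k * w ^ k)"
            using w pos by (intro sum_le_suminf) (auto simp: sums_iff)
          ultimately show ?thesis
            by (simp add: sums_iff)
        qed
        then have "(w powr (b - 1) * (1 - w) powr (c - b - 1)) * (\<Sum>k\<le>N. pochhammer a k / fact k * w ^ k) \<le>
           (w powr (b - 1) * (1 - w) powr (c - b - 1)) * (1 - w) powr (-a)"
          by (intro mult_left_mono) auto
        then show "(\<Sum>k\<le>N. pochhammer a k / fact k * (w powr (b + real k - 1) * (1 - w) powr (c - b - 1)))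
           \<le> w powr (b - 1) * (1 - w) powr (c - a - b - 1)"
          using w by (simp add: sum_distrib_left pw1 pw2 mult_ac)
      qed (use bs bd in \<open>auto simp: has_bochner_integral_iff\<close>)
      with bs bd show ?thesis
        by (simp add: has_bochner_integral_iff)
    qed
    then show "(\<Sum>k\<le>N. \<bar>pochhammer a k\<bar> * pochhammer b k / (pochhammer c k * fact k) * 1 ^ k) \<le> Beta b (c - a - b) / Beta b (c - b)"
      using B pos by (simp add: Beta_pochhammer[OF b c'] field_simps sum_distrib_left)
  qed (use pos in \<open>auto simp: less_imp_le\<close>)
  from Euler_integral_hyp2F1_if_summable[OF b c' _ _ this]
  have "has_bochner_integral unit_lborel (\<lambda>w. w powr (b - 1) * (1 - w) powr (c - b - 1) * (1 - w) powr (-a))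
           (Beta b (c - b) * hyp2F1 a b c 1)" by simp
  moreover have "w powr (b - 1) * (1 - w) powr (c - b - 1) * (1 - w) powr (-a) = w powr (b - 1) * (1 - w) powr (c - a - b - 1)" for w :: real
    by (simp add: mult.assoc flip: powr_add) (simp add: algebra_simps)
  ultimately show ?thesis
    using bd by (auto simp: has_bochner_integral_iff)
qed

lemma hyp2F1_commute: "hyp2F1 a b c z = hyp2F1 b a c z"
  unfolding hyp2F1_eq_suminf by (simp add: mult.commute mult.left_commute)

section \<open>Holomorphy of exponential integrals\<close>

text \<open>Expanding \<open>exp((z - c) L)\<close> at a real centre \<open>c > \<sigma>\<close> and integrating term by term gives a power
  series for the integral. Because \<open>L \<le> 0\<close>, the sum of the absolute values of the terms is
  \<open>g exp((c - |z - c|) L)\<close>, integrable as long as \<open>|z - c| < c - \<sigma>\<close>; and the discs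
  touching the line \<open>Re z = \<sigma>\<close> from the right exhaust the half-plane.\<close>
lemma holomorphic_exp_integral:
  fixes g L :: "'a \<Rightarrow> real" and \<sigma> :: real
  assumes [measurable]: "g \<in> borel_measurable M" "L \<in> borel_measurable M"
    and g: "\<And>x. x \<in> space M \<Longrightarrow> g x \<ge> 0" and L: "\<And>x. x \<in> space M \<Longrightarrow> L x \<le> 0"
    and int: "\<And>s. s > \<sigma> \<Longrightarrow> integrable M (\<lambda>x. g x * exp (s * L x))"
  shows "(\<lambda>z. LINT x|M. complex_of_real (g x) * exp (z * complex_of_real (L x)))
           holomorphic_on {z. Re z > \<sigma>}"
proof -
  define F where "F = (\<lambda>z. LINT x|M. complex_of_real (g x) * exp (z * complex_of_real (L x)))"
  have hol: "F holomorphic_on ball (of_real c) (c - \<sigma>)" for c :: real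
  proof (rule power_series_holomorphic)
    fix w assume w: "w \<in> ball (complex_of_real c) (c - \<sigma>)"
    define h where "h = w - of_real c"
    have h: "cmod h < c - \<sigma>"
      using w by (simp add: h_def dist_norm norm_minus_commute)
    define f where "f = (\<lambda>k x. complex_of_real (g x * exp (c * L x)) * (h * of_real (L x)) ^ k /\<^sub>R fact k)"
    define D where "D = (\<lambda>x. g x * exp ((c - cmod h) * L x))"
    have D: "integrable M D"
      unfolding D_def using h by (intro int) simp
    have [measurable]: "f k \<in> borel_measurable M" for k
      unfolding f_def by measurable
    have f_sums: "(\<lambda>k. f k x) sums (complex_of_real (g x) * exp (w * of_real (L x)))" for x
    proof -
      have "(\<lambda>k. complex_of_real (g x * exp (c * L x)) * ((h * of_real (L x)) ^ k /\<^sub>R fact k)) sums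
        (complex_of_real (g x * exp (c * L x)) * exp (h * of_real (L x)))"
        by (intro sums_mult exp_converges)
      also have "complex_of_real (g x * exp (c * L x)) * exp (h * of_real (L x)) =
        complex_of_real (g x) * exp (w * of_real (L x))"
        by (simp add: h_def exp_of_real[symmetric] left_diff_distrib exp_diff)
      finally show ?thesis by (simp add: f_def)
    qed
    have norm_f: "norm (f k x) = g x * exp (c * L x) * ((cmod h * (- L x)) ^ k /\<^sub>R fact k)"
      if x: "x \<in> space M" for k x
      using g[OF x] L[OF x] by (simp add: f_def norm_mult norm_power)
    have norm_sums: "(\<lambda>k. norm (f k x)) sums D x" if x: "x \<in> space M" for x
    proof -
      have "(\<lambda>k. g x * exp (c * L x) * ((cmod h * (- L x)) ^ k /\<^sub>R fact k)) sums
         (g x * exp (c * L x) * exp (cmod h * (- L x)))"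
        by (intro sums_mult exp_converges)
      also have "g x * exp (c * L x) * exp (cmod h * (- L x)) = D x"
        by (simp add: D_def left_diff_distrib exp_diff exp_minus field_simps)
      finally show ?thesis by (simp add: norm_f[OF x])
    qed
    have bound: "(\<Sum>k\<in>A. norm (f k x)) \<le> D x" if x: "x \<in> space M" and "finite A" for x A
    proof -
      have "(\<Sum>k\<in>A. norm (f k x)) \<le> (\<Sum>k. norm (f k x))"
        using norm_sums[OF x] \<open>finite A\<close> by (intro sum_le_suminf) (auto simp: sums_iff)
      with norm_sums[OF x] show ?thesis by (simp add: sums_iff)
    qed
    have f_int: "integrable M (f k)" for k
    proof (rule Bochner_Integration.integrable_bound[OF D])
      show "AE x in M. norm (f k x) \<le> norm (D x)"
      proof (rule AE_I2)
        fix x assume "x \<in> space M"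
        then show "norm (f k x) \<le> norm (D x)" using bound[of x "{k}"] by simp
      qed
    qed measurable
    have "(\<lambda>N. LINT x|M. (\<Sum>k<N. f k x)) \<longlonglongrightarrow> (LINT x|M. complex_of_real (g x) * exp (w * of_real (L x)))"
    proof (rule integral_dominated_convergence[where w = D])
      show "AE x in M. (\<lambda>N. \<Sum>k<N. f k x) \<longlonglongrightarrow> complex_of_real (g x) * exp (w * of_real (L x))"
        using f_sums by (auto simp: sums_def)
      fix N show "AE x in M. norm (\<Sum>k<N. f k x) \<le> D x"
        using bound by (intro AE_I2) (auto intro: order_trans[OF norm_sum])
    qed (use D in auto)
    also have "(\<lambda>N. LINT x|M. (\<Sum>k<N. f k x)) = (\<lambda>N. \<Sum>k<N. LINT x|M. f k x)"
      using f_int by (intro ext Bochner_Integration.integral_sum) auto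
    finally have "(\<lambda>k. LINT x|M. f k x) sums F w" by (simp add: sums_def F_def)
    moreover have "(LINT x|M. f k x) =
        (LINT x|M. complex_of_real (g x * exp (c * L x)) * of_real (L x) ^ k /\<^sub>R fact k) * (w - of_real c) ^ k" for k
      by (subst Bochner_Integration.integral_mult_left_zero[symmetric])
        (simp add: f_def h_def power_mult_distrib mult_ac)
    ultimately show "(\<lambda>k. (LINT x|M. complex_of_real (g x * exp (c * L x)) * of_real (L x) ^ k /\<^sub>R fact k) * (w - of_real c) ^ k) sums F w"
      by simp
  qed
  have "F field_differentiable at z" if z: "Re z > \<sigma>" for z
  proof -
    \<comment> \<open>\<open>z\<close> lies in the disc about \<open>c\<close> of radius \<open>c - \<sigma>\<close> iff
      \<open>(Im z)^2 < (Re z - \<sigma>) (2 c - \<sigma> - Re z)\<close>, which holds for large \<open>c\<close>.\<close>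
    define a where "a = (Im z)\<^sup>2 / (Re z - \<sigma>)"
    define c where "c = (a + \<sigma> + Re z) / 2 + 1"
    have a: "a \<ge> 0" "(Re z - \<sigma>) * a = (Im z)\<^sup>2" using z by (simp_all add: a_def)
    have c: "c > \<sigma>" 
      using z a(1) by (simp add: c_def field_simps)
    have "(Re z - \<sigma>) * (2 * c - \<sigma> - Re z) = (Re z - \<sigma>) * a + 2 * (Re z - \<sigma>)"
    proof -
      have "2 * c = a + \<sigma> + Re z + 2" by (simp add: c_def field_simps)
      then show ?thesis by (simp add: algebra_simps)
    qed
    then have "(Re z - \<sigma>) * (2 * c - \<sigma> - Re z) = (Im z)\<^sup>2 + 2 * (Re z - \<sigma>)"
      by (simp only: a)
    moreover have "(c - \<sigma>)\<^sup>2 = (Re z - c)\<^sup>2 + (Re z - \<sigma>) * (2 * c - \<sigma> - Re z)"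
      by (simp add: power2_eq_square algebra_simps)
    ultimately have "(cmod (z - of_real c))\<^sup>2 < (c - \<sigma>)\<^sup>2"
      using z by (simp add: cmod_power2)
    then have "z \<in> ball (of_real c) (c - \<sigma>)"
      using c by (auto simp: dist_norm norm_minus_commute intro: power2_less_imp_less)
    then show ?thesis
      using hol[of c] by (auto intro: holomorphic_on_imp_differentiable_at)
  qed
  then show ?thesis
    unfolding F_def[symmetric] by (auto simp: holomorphic_on_def intro: field_differentiable_at_within)
qed

section \<open>The right-hand side as a triple integral\<close>

text \<open>The double integral of the theorem, with \<open>e = n + s\<close>, after the hypergeometric function at
  \<open>1 - xy\<close> has been replaced by its Euler integral with variable \<open>w\<close>. It is used with both
  assignments of \<open>s + 1\<close> and \<open>n + s + 1\<close> to \<open>a\<close> and \<open>b\<close>.\<close>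
definition euler_kernel :: "real \<Rightarrow> real \<Rightarrow> real \<Rightarrow> real \<Rightarrow> real \<Rightarrow> real \<Rightarrow> real \<Rightarrow> real \<Rightarrow> real \<Rightarrow> real" where
  "euler_kernel p q e a b c x y w =
     x powr (p - 1) * y powr (q - 1) * (1 - x) powr e * (1 - y) powr e *
     (w powr (b - 1) * (1 - w) powr (c - b - 1) * (1 - (1 - x * y) * w) powr (-a))"

lemma euler_kernel_measurable:
  "(\<lambda>(y, x, w). euler_kernel p q e a b c x y w) \<in> borel_measurable (borel \<Otimes>\<^sub>M borel \<Otimes>\<^sub>M borel)"
  unfolding euler_kernel_def by measurable

lemma euler_kernel_nonneg: "euler_kernel p q e a b c x y w \<ge> 0"
  by (simp add: euler_kernel_def)

lemma euler_denom_pos: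
  fixes x y w :: real
  assumes "x \<in> {0<..<1}" "y \<in> {0<..<1}" "w \<in> {0<..<1}"
  shows "1 - w < 1 - (1 - x * y) * w" "1 - (1 - x * y) * w < 1" "0 < 1 - x * y" "1 - x * y < 1"
proof -
  have "x * y * w > 0" using assms by simp
  then show "1 - w < 1 - (1 - x * y) * w" by (simp add: algebra_simps)
  have "x * y < 1 * 1" using assms by (intro mult_strict_mono) auto
  then show "0 < 1 - x * y" by simp
  then have "(1 - x * y) * w > 0" using assms by simp
  then show "1 - (1 - x * y) * w < 1" by simp
  show "1 - x * y < 1" using assms by simp
qed

text \<open>As \<open>1 - w \<le> 1 - (1 - xy)w \<le> 1\<close>, the coupling factor is at most
  \<open>(1 - w)^(-max a 0)\<close>, and what is left is a product of three convergent Beta integrals.\<close>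
lemma euler_kernel_integrable:
  assumes "p > 0" "q > 0" "e > -1" "b > 0" "c > b" "c > a + b"
  shows "integrable (unit_lborel \<Otimes>\<^sub>M unit_lborel \<Otimes>\<^sub>M unit_lborel)
    (\<lambda>(y, x, w). euler_kernel p q e a b c x y w)"
proof -
  define B where "B = (\<lambda>\<alpha> \<beta> t. t powr (\<alpha> - 1) * (1 - t) powr (\<beta> - 1) :: real)"
  define \<gamma> where "\<gamma> = c - b - max a 0"
  have \<gamma>: "\<gamma> > 0" using assms by (auto simp: \<gamma>_def)
  have B_fin: "(\<integral>\<^sup>+t. ennreal (B \<alpha> \<beta> t) \<partial>unit_lborel) < \<infinity>" if "\<alpha> > 0" "\<beta> > 0" for \<alpha> \<beta>
  proof -
    have "has_bochner_integral unit_lborel (B \<alpha> \<beta>) (Beta \<alpha> \<beta>)"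
      unfolding B_def by (rule has_bochner_integral_Beta[OF that])
    then have "(\<integral>\<^sup>+t. ennreal (B \<alpha> \<beta> t) \<partial>unit_lborel) = ennreal (Beta \<alpha> \<beta>)"
      by (intro nn_integral_eq_integral[THEN trans]) (auto simp: has_bochner_integral_iff B_def)
    then show ?thesis by simp
  qed
  have B_nn: "B \<alpha> \<beta> t \<ge> 0" for \<alpha> \<beta> t by (simp add: B_def)
  have [measurable]: "(\<lambda>t. ennreal (B \<alpha> \<beta> t)) \<in> borel_measurable unit_lborel" for \<alpha> \<beta>
    unfolding B_def by (intro measurable_unit_lborelI) measurable
  have le: "euler_kernel p q e a b c x y w \<le> B q (e + 1) y * (B p (e + 1) x * B b \<gamma> w)"
    if xyw: "y \<in> {0<..<1}" "x \<in> {0<..<1}" "w \<in> {0<..<1}" for x y w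
  proof -
    note den = euler_denom_pos[OF that(2,1,3)]
    have "(1 - (1 - x * y) * w) powr (-a) \<le> (1 - w) powr (- max a 0)"
    proof (cases "a \<ge> 0")
      case True
      then have "(1 - (1 - x * y) * w) powr (-a) \<le> (1 - w) powr (-a)"
        using den xyw by (intro powr_mono2') auto
      with True show ?thesis by simp
    next
      case False
      then have "(1 - (1 - x * y) * w) powr (-a) \<le> 1 powr (-a)"
        using den xyw by (intro powr_mono2) auto
      with False xyw show ?thesis by (simp add: max_def)
    qed
    then have "w powr (b - 1) * (1 - w) powr (c - b - 1) * (1 - (1 - x * y) * w) powr (-a) \<le>
      w powr (b - 1) * (1 - w) powr (c - b - 1) * (1 - w) powr (- max a 0)"
      by (intro mult_left_mono) auto
    also have "\<dots> = B b \<gamma> w"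
      by (simp add: B_def \<gamma>_def mult.assoc flip: powr_add) (simp add: algebra_simps)
    finally have "w powr (b - 1) * (1 - w) powr (c - b - 1) * (1 - (1 - x * y) * w) powr (-a) \<le> B b \<gamma> w" .
    then have "B q (e + 1) y * (B p (e + 1) x * (w powr (b - 1) * (1 - w) powr (c - b - 1) * (1 - (1 - x * y) * w) powr (-a)))
      \<le> B q (e + 1) y * (B p (e + 1) x * B b \<gamma> w)"
      by (intro mult_left_mono B_nn)
    then show ?thesis
      by (simp add: euler_kernel_def B_def mult_ac)
  qed
  have "(\<integral>\<^sup>+(y, x, w). ennreal (euler_kernel p q e a b c x y w) \<partial>(unit_lborel \<Otimes>\<^sub>M unit_lborel \<Otimes>\<^sub>M unit_lborel)) =
     (\<integral>\<^sup>+y. \<integral>\<^sup>+x. \<integral>\<^sup>+w. ennreal (euler_kernel p q e a b c x y w) \<partial>unit_lborel \<partial>unit_lborel \<partial>unit_lborel)"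
    by (rule nn_integral_unit_lborel_triple[symmetric]) (unfold euler_kernel_def, measurable)
  also have "\<dots> \<le> (\<integral>\<^sup>+y. \<integral>\<^sup>+x. \<integral>\<^sup>+w. ennreal (B q (e + 1) y) * (ennreal (B p (e + 1) x) * ennreal (B b \<gamma> w))
      \<partial>unit_lborel \<partial>unit_lborel \<partial>unit_lborel)"
    using le by (intro nn_integral_mono) (simp add: B_nn flip: ennreal_mult)
  also have "\<dots> = (\<integral>\<^sup>+t. ennreal (B q (e + 1) t) \<partial>unit_lborel) *
      ((\<integral>\<^sup>+t. ennreal (B p (e + 1) t) \<partial>unit_lborel) * (\<integral>\<^sup>+t. ennreal (B b \<gamma> t) \<partial>unit_lborel))"
    by (simp add: nn_integral_cmult nn_integral_multc)
  also have "\<dots> < \<infinity>"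
    using assms \<gamma> by (simp add: ennreal_mult_less_top B_fin[unfolded infinity_ennreal_def])
  finally have fin: "(\<integral>\<^sup>+(y, x, w). ennreal (euler_kernel p q e a b c x y w)
    \<partial>(unit_lborel \<Otimes>\<^sub>M unit_lborel \<Otimes>\<^sub>M unit_lborel)) < \<infinity>" .
  show ?thesis
  proof (rule integrableI_nonneg)
    show "(\<lambda>(y, x, w). euler_kernel p q e a b c x y w) \<in> borel_measurable (unit_lborel \<Otimes>\<^sub>M unit_lborel \<Otimes>\<^sub>M unit_lborel)"
      by (intro measurable_unit_lborel_tripleI euler_kernel_measurable)
  qed (use fin in \<open>auto simp: euler_kernel_nonneg case_prod_unfold\<close>)
qed

lemma LINT_hyp2F1_eq_euler_kernel:
  assumes "p > 0" "q > 0" "e > -1" "b > 0" "c > b" "c > a + b"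
  shows "Beta b (c - b) * (LINT y|unit_lborel. LINT x|unit_lborel.
      x powr (p - 1) * y powr (q - 1) * (1 - x) powr e * (1 - y) powr e * hyp2F1 a b c (1 - x * y)) =
    (LINT (y, x, w)|(unit_lborel \<Otimes>\<^sub>M unit_lborel \<Otimes>\<^sub>M unit_lborel). euler_kernel p q e a b c x y w)"
proof -
  have "(LINT w|unit_lborel. euler_kernel p q e a b c x y w) =
     x powr (p - 1) * y powr (q - 1) * (1 - x) powr e * (1 - y) powr e * (Beta b (c - b) * hyp2F1 a b c (1 - x * y))"
    if "x \<in> {0<..<1}" "y \<in> {0<..<1}" for x y
  proof -
    have "x * y < 1 * 1" using that by (intro mult_strict_mono) auto
    then have "has_bochner_integral unit_lborel
      (\<lambda>w. w powr (b - 1) * (1 - w) powr (c - b - 1) * (1 - (1 - x * y) * w) powr (-a))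
      (Beta b (c - b) * hyp2F1 a b c (1 - x * y))"
      using that assms by (intro Euler_integral_hyp2F1) auto
    then show ?thesis
      unfolding euler_kernel_def by (simp add: has_bochner_integral_integral_eq)
  qed
  then have "(LINT y|unit_lborel. LINT x|unit_lborel. LINT w|unit_lborel. euler_kernel p q e a b c x y w) =
     (LINT y|unit_lborel. LINT x|unit_lborel. Beta b (c - b) *
       (x powr (p - 1) * y powr (q - 1) * (1 - x) powr e * (1 - y) powr e * hyp2F1 a b c (1 - x * y)))"
    by (intro Bochner_Integration.integral_cong refl) (simp add: mult_ac)
  moreover have "(LINT y|unit_lborel. LINT x|unit_lborel. LINT w|unit_lborel. euler_kernel p q e a b c x y w) =
    (LINT (y, x, w)|(unit_lborel \<Otimes>\<^sub>M unit_lborel \<Otimes>\<^sub>M unit_lborel). euler_kernel p q e a b c x y w)"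
    by (intro LINT_unit_lborel_triple euler_kernel_integrable euler_kernel_measurable assms)
  ultimately show ?thesis by simp
qed

text \<open>With \<open>b = n + s + 1\<close> the parameter \<open>s\<close> occurs only as the exponent of
  \<open>(1-x)(1-y)w(1-w) / (1-(1-xy)w) \<le> 1\<close>, so the integral is of the exponential type
  and converges for all \<open>s > -n-1\<close>.\<close>
lemma holomorphic_euler_kernel:
  fixes n p q :: nat
  assumes "n \<ge> 1" "p \<ge> 1" "q \<ge> 1"
  obtains F where "F holomorphic_on {z. Re z > - real n - 1}"
    "\<And>s. s > - real n - 1 \<Longrightarrow> F (complex_of_real s) =
       complex_of_real (LINT (y, x, w)|(unit_lborel \<Otimes>\<^sub>M unit_lborel \<Otimes>\<^sub>M unit_lborel).
         euler_kernel (real p) (real q) (real n + s) (s + 1) (real n + s + 1) (2 * real n + 2 * s + 2) x y w)"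
proof -
  let ?M = "unit_lborel \<Otimes>\<^sub>M unit_lborel \<Otimes>\<^sub>M unit_lborel"
  define K where "K = (\<lambda>s (y, x, w). euler_kernel (real p) (real q) (real n + s) (s + 1) (real n + s + 1) (2 * real n + 2 * s + 2) x y w)"
  define L :: "real \<times> real \<times> real \<Rightarrow> real" where
    "L = (\<lambda>(y, x, w). ln ((1 - x) * (1 - y) * w * (1 - w) / (1 - (1 - x * y) * w)))"
  define F where "F = (\<lambda>z. LINT x|?M. complex_of_real (K 0 x) * exp (z * complex_of_real (L x)))"
  have space: "\<omega> \<in> space ?M \<longleftrightarrow> (\<exists>x y w. \<omega> = (y, x, w) \<and> y \<in> {0<..<1} \<and> x \<in> {0<..<1} \<and> w \<in> {0<..<1})" for \<omega>
    by (cases \<omega>) (auto simp: space_pair_measure)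
  have K_exp: "K 0 \<omega> * exp (s * L \<omega>) = K s \<omega>" if \<omega>: "\<omega> \<in> space ?M" for s \<omega>
  proof -
    from \<omega> obtain x y w where xyw: "\<omega> = (y, x, w)" "y \<in> {0<..<1}" "x \<in> {0<..<1}" "w \<in> {0<..<1}"
      unfolding space by blast
    define z where "z = 1 - (1 - x * y) * w"
    have "z > 0" using euler_denom_pos[OF xyw(3,2,4)] xyw by (simp add: z_def)
    have "L \<omega> = ln ((1 - x) * (1 - y) * w * (1 - w) / z)"
      by (simp only: L_def xyw(1) z_def prod.case)
    also have "\<dots> = ln (1 - x) + ln (1 - y) + ln w + ln (1 - w) - ln z"
      using xyw \<open>z > 0\<close> by (simp add: ln_mult ln_div)
    finally have E: "exp (r * L \<omega>) = (1 - x) powr r * (1 - y) powr r * w powr r * (1 - w) powr r * z powr (- r)" for r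
      using xyw \<open>z > 0\<close> by (simp add: powr_def flip: exp_add) (simp add: algebra_simps)
    define C where "C = x powr (real p - 1) * y powr (real q - 1) * (1 - x) powr real n * (1 - y) powr real n *
      w powr real n * (1 - w) powr real n * z powr (- 1)"
    have "K r \<omega> = C * exp (r * L \<omega>)" for r
    proof -
      have ex: "2 * real n + 2 * r + 2 - (real n + r + 1) - 1 = real n + r" "real n + r + 1 - 1 = real n + r"
        "- (r + 1) = - 1 + - r" by simp_all
      have "K r \<omega> = x powr (real p - 1) * y powr (real q - 1) * (1 - x) powr (real n + r) * (1 - y) powr (real n + r) *
        (w powr (real n + r) * (1 - w) powr (real n + r) * z powr (- 1 + - r))"
        by (simp only: K_def xyw(1) prod.case euler_kernel_def z_def ex)
      also have "\<dots> = C * exp (r * L \<omega>)"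
        unfolding E C_def powr_add by (simp only: mult_ac)
      finally show ?thesis .
    qed
    then show ?thesis by simp
  qed
  have L_le: "L \<omega> \<le> 0" if \<omega>: "\<omega> \<in> space ?M" for \<omega>
  proof -
    from \<omega> obtain x y w where xyw: "\<omega> = (y, x, w)" "y \<in> {0<..<1}" "x \<in> {0<..<1}" "w \<in> {0<..<1}"
      unfolding space by blast
    note den = euler_denom_pos[OF xyw(3,2,4)]
    have "(1 - x) * (1 - y) * w * (1 - w) \<le> 1 * (1 - w)"
      using xyw by (intro mult_right_mono mult_le_one) auto
    also have "\<dots> \<le> 1 - (1 - x * y) * w" using den by simp
    finally show ?thesis
      using xyw den by (simp add: L_def)
  qed
  have K_int: "integrable ?M (K s)" if "s > - real n - 1" for s
    unfolding K_def using assms that by (intro euler_kernel_integrable) auto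
  have K_meas: "K s \<in> borel_measurable ?M" for s
    unfolding K_def by (intro measurable_unit_lborel_tripleI euler_kernel_measurable)
  have L_meas: "L \<in> borel_measurable ?M"
    unfolding L_def by (intro measurable_unit_lborel_tripleI) measurable
  have "F holomorphic_on {z. Re z > - real n - 1}"
    unfolding F_def
  proof (rule holomorphic_exp_integral[OF K_meas L_meas])
    fix s assume "s > - real n - 1"
    then show "integrable ?M (\<lambda>x. K 0 x * exp (s * L x))"
      using K_int[of s] K_exp[of _ s] by (simp cong: Bochner_Integration.integrable_cong)
  qed (use L_le in \<open>auto simp: K_def euler_kernel_nonneg split: prod.splits\<close>)
  moreover have "F (complex_of_real s) = complex_of_real (LINT x|?M. K s x)" for s
  proof -
    have "F (complex_of_real s) = (LINT x|?M. complex_of_real (K s x))"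
      unfolding F_def
      by (rule Bochner_Integration.integral_cong) (simp_all add: K_exp exp_of_real flip: of_real_mult)
    then show ?thesis by simp
  qed
  ultimately show ?thesis
    using that unfolding K_def by blast
qed

section \<open>The Moebius substitutions\<close>

text \<open>The Moebius transformation of the unit interval that fixes both end points and has derivative
  \<open>1 - k\<close> at \<open>0\<close>.\<close>
definition moebius :: "real \<Rightarrow> real \<Rightarrow> real" where
  "moebius k w = w * (1 - k) / (1 - k * w)"

lemma moebius_denom_pos:
  fixes k w :: real assumes "k < 1" "0 \<le> w" "w \<le> 1" shows "1 - k * w > 0"
proof -
  have eq: "1 - k * w = (1 - w) + w * (1 - k)" by (simp add: algebra_simps)
  show ?thesis
    using assms unfolding eq by (cases "w = 0") (auto intro: add_nonneg_pos)
qed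

lemma moebius_in_unit:
  assumes "k < 1" "0 < w" "w < 1"
  shows "moebius k w \<in> {0<..<1}"
proof -
  have "0 < 1 - k * w" "0 < w * (1 - k)" "w * (1 - k) < 1 - k * w"
    using assms moebius_denom_pos[of k w] by (auto simp: algebra_simps)
  then show ?thesis by (simp add: moebius_def)
qed

text \<open>Stated for arbitrary measurable integrands with values in the extended nonnegative reals,
  because the integrand is itself an integral in the application. For this reason the proof first
  identifies Lebesgue measure with an image measure, testing only on indicator functions.\<close>
lemma nn_integral_moebius:
  assumes k: "k < 1" and f: "f \<in> borel_measurable unit_lborel"
  shows "(\<integral>\<^sup>+x. f x \<partial>unit_lborel) =
    (\<integral>\<^sup>+w. ennreal ((1 - k) / (1 - k * w)\<^sup>2) * f (moebius k w) \<partial>unit_lborel)"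
proof -
  define D where "D = (\<lambda>w. (1 - k) / (1 - k * w)\<^sup>2)"
  have D_meas: "(\<lambda>w. ennreal (D w)) \<in> borel_measurable unit_lborel"
    unfolding D_def by (intro measurable_unit_lborelI) measurable
  have m_meas: "moebius k \<in> unit_lborel \<rightarrow>\<^sub>M unit_lborel"
    unfolding unit_lborel_def
  proof (rule measurable_restrict_space2)
    show "moebius k \<in> space (restrict_space lborel {0<..<1}) \<rightarrow> {0<..<1}"
      using moebius_in_unit[OF k] by (auto simp: space_restrict_space)
    show "moebius k \<in> restrict_space lborel {0<..<1} \<rightarrow>\<^sub>M lborel"
      unfolding moebius_def [abs_def] measurable_lborel1 measurable_lborel2
      by (intro measurable_restrict_space1) measurable
  qed
  have "unit_lborel = distr (density unit_lborel (\<lambda>w. ennreal (D w))) unit_lborel (moebius k)"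
  proof (rule measure_eqI)
    fix A assume A: "A \<in> sets unit_lborel"
    then have A': "A \<in> sets borel" "A \<subseteq> {0<..<1}"
      by (auto simp: unit_lborel_def sets_restrict_space)
    have ends: "moebius k 0 = 0" "moebius k 1 = 1"
      using k by (auto simp: moebius_def)
    have "emeasure unit_lborel A = (\<integral>\<^sup>+x. indicator A x \<partial>unit_lborel)"
      using A by simp
    also have "\<dots> = (\<integral>\<^sup>+x. ennreal (indicator A x) * indicator {moebius k 0..moebius k 1} x \<partial>lborel)"
      unfolding nn_integral_unit_lborel ends using A'
      by (intro nn_integral_cong) (auto simp: indicator_def)
    also have "\<dots> = (\<integral>\<^sup>+x. ennreal (indicator A (moebius k x) * D x) * indicator {0..1} x \<partial>lborel)"
    proof -
      have "(\<integral>\<^sup>+x. ennreal (indicator A x * indicator {moebius k 0..moebius k 1} x) \<partial>lborel) =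
            (\<integral>\<^sup>+x. ennreal (indicator A (moebius k x) * D x * indicator {0..1} x) \<partial>lborel)"
      proof (rule nn_integral_substitution)
        show "set_borel_measurable borel {moebius k 0..moebius k 1} (indicat_real A)"
          using A' unfolding set_borel_measurable_def
          by (intro borel_measurable_scaleR borel_measurable_indicator) auto
        fix x :: real assume x: "x \<in> {0..1}"
        then have "1 - k * x > 0" using moebius_denom_pos k by auto
        moreover from this have "k * x \<noteq> 1" by simp
        ultimately show "(moebius k has_real_derivative D x) (at x)"
          unfolding moebius_def [abs_def] D_def
          by (auto intro!: derivative_eq_intros simp: field_simps power2_eq_square)
        show "0 \<le> D x" using k by (simp add: D_def)
      next
        have "1 - k * x \<noteq> 0" if "x \<in> {0..1}" for x
          using moebius_denom_pos k that by force
        then show "continuous_on {0..1} D"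
          unfolding D_def by (intro continuous_intros) auto
      qed simp
      then show ?thesis by (simp add: ennreal_mult'' ennreal_indicator)
    qed
    also have "\<dots> = (\<integral>\<^sup>+x. ennreal (D x) * indicator A (moebius k x) \<partial>unit_lborel)"
      unfolding nn_integral_unit_lborel
    proof (rule nn_integral_cong)
      fix x :: real
      have "0 \<le> D x" using k by (simp add: D_def)
      then show "ennreal (indicator A (moebius k x) * D x) * indicator {0..1} x =
        ennreal (D x) * indicator A (moebius k x) * indicator {0<..<1} x"
        using A' ends by (cases "x = 0 \<or> x = 1") (auto simp: indicator_def)
    qed
    also have "\<dots> = (\<integral>\<^sup>+x. indicator A x \<partial>distr (density unit_lborel (\<lambda>w. ennreal (D w))) unit_lborel (moebius k))"
      using A D_meas m_meas
      by (subst nn_integral_distr) (auto simp: nn_integral_density intro: measurable_compose)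
    also have "\<dots> = emeasure (distr (density unit_lborel (\<lambda>w. ennreal (D w))) unit_lborel (moebius k)) A"
      using A by simp
    finally show "emeasure unit_lborel A = \<dots>" .
  qed simp
  then have "(\<integral>\<^sup>+x. f x \<partial>unit_lborel) =
    (\<integral>\<^sup>+x. f x \<partial>distr (density unit_lborel (\<lambda>w. ennreal (D w))) unit_lborel (moebius k))"
    by metis
  also have "\<dots> = (\<integral>\<^sup>+w. ennreal (D w) * f (moebius k w) \<partial>unit_lborel)"
    using m_meas f D_meas
    by (subst nn_integral_distr) (auto simp: nn_integral_density intro: measurable_compose)
  finally show ?thesis by (simp add: D_def)
qed

text \<open>The integrand of \<open>c_pq(s)\<close> once both factors \<open>S_pq(t)\<close> are replaced by their Euler integrals,
  up to a constant. The two factors use the two different choices of Euler integral (variable \<open>u\<close>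
  with \<open>b = p\<close>, variable \<open>v\<close> with \<open>b = q\<close>); this is what makes the kernel symmetric
  under exchanging \<open>(p,u)\<close> and \<open>(q,v)\<close>, like the other side.\<close>
definition S_kernel :: "real \<Rightarrow> real \<Rightarrow> real \<Rightarrow> real \<Rightarrow> real \<Rightarrow> real \<Rightarrow> real \<Rightarrow> real" where
  "S_kernel n p q s t v u =
     t powr (p + q + n - 1) * (1 - t) powr s *
     (u powr (p - 1) * (1 - u) powr (q + n - 1) * (1 - t * u) powr (-q)) *
     (v powr (q - 1) * (1 - v) powr (p + n - 1) * (1 - t * v) powr (-p))"

text \<open>Equality of the two integrands, Jacobians included. With \<open>A = 1 - wu\<close>, \<open>B = 1 - wv\<close> and
  \<open>C = 1 - kw\<close> every quantity that is raised to a power becomes a monomial in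
  \<open>u\<close>, \<open>v\<close>, \<open>w\<close>, \<open>1-u\<close>, \<open>1-v\<close>, \<open>1-w\<close>, \<open>A\<close>, \<open>B\<close>, \<open>C\<close>, for instance
  \<open>1 - tu = (1-u)B/C\<close> and \<open>1 - (1-xy)w = (1-w)C/(AB)\<close>. After taking logarithms the
  claim is therefore linear in the logarithms of these nine positive numbers.\<close>
lemma moebius_kernel_identity:
  fixes u v w n p q s :: real
  assumes u: "u \<in> {0<..<1}" and v: "v \<in> {0<..<1}" and w: "w \<in> {0<..<1}"
  defines "k \<equiv> u + v - u * v"
  shows "(1 - w) / (1 - w * v)\<^sup>2 * ((1 - w) / (1 - w * u)\<^sup>2 *
      euler_kernel p q (n + s) (n + s + 1) (s + 1) (2 * n + 2 * s + 2) (moebius w u) (moebius w v) w) =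
    (1 - k) / (1 - k * w)\<^sup>2 * S_kernel n p q s (1 - moebius k w) v u" (is "?l = ?r")
proof -
  define A where "A = 1 - w * u"
  define B where "B = 1 - w * v"
  define C where "C = 1 - k * w"
  have k: "1 - k = (1 - u) * (1 - v)" by (simp add: k_def algebra_simps)
  have "(1 - u) * (1 - v) > 0" using u v by simp
  then have "k < 1" using k by simp
  have A: "A > 0" and B: "B > 0" and C: "C > 0"
    using moebius_denom_pos[of w u] moebius_denom_pos[of w v] moebius_denom_pos[of k w] \<open>k < 1\<close> u v w
    by (auto simp: A_def B_def C_def)
  have x: "moebius w u = u * (1 - w) / A" "1 - moebius w u = (1 - u) / A"
   and y: "moebius w v = v * (1 - w) / B" "1 - moebius w v = (1 - v) / B"
    using A B by (simp_all add: moebius_def A_def B_def field_simps)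
  have t: "moebius k w = w * ((1 - u) * (1 - v)) / C" "1 - moebius k w = (1 - w) / C"
    using C unfolding k[symmetric] by (simp_all add: moebius_def C_def field_simps)
  have tt: "1 - (1 - moebius k w) = w * ((1 - u) * (1 - v)) / C"
    using t(1) by simp
  have tu: "1 - (1 - moebius k w) * u = (1 - u) * B / C"
    and tv: "1 - (1 - moebius k w) * v = (1 - v) * A / C"
    unfolding t(2) using C by (simp_all add: field_simps) (simp_all add: A_def B_def C_def k_def algebra_simps)
  have z: "1 - (1 - moebius w u * moebius w v) * w = (1 - w) * C / (A * B)"
    unfolding x y using A B by (simp add: field_simps) (simp add: A_def B_def C_def k_def algebra_simps)
  have l_pos: "?l > 0" and r_pos: "?r > 0"
    using A B C u v w unfolding euler_kernel_def S_kernel_def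
    unfolding z tu tv tt unfolding x(2) y(2) t(2) unfolding x(1) y(1) t(1) k
    unfolding A_def[symmetric] B_def[symmetric] C_def[symmetric] by auto
  have "ln ?l = ln ?r"
    using A B C u v w unfolding euler_kernel_def S_kernel_def
    unfolding z tu tv tt unfolding x(2) y(2) t(2) unfolding x(1) y(1) t(1) k
    unfolding A_def[symmetric] B_def[symmetric] C_def[symmetric]
    by (simp add: ln_mult ln_div ln_powr ln_realpow) (simp add: algebra_simps)
  then show ?thesis using l_pos r_pos by (metis exp_ln)
qed

text \<open>The order of the substitutions matters: \<open>x\<close> and \<open>y\<close> are replaced by \<open>u\<close> and \<open>v\<close> with \<open>w\<close> held
  fixed, and only then \<open>w\<close> is traded for \<open>t\<close> with \<open>u\<close> and \<open>v\<close> held fixed. Working with nonnegative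
  integrals allows any order of integration without a convergence discussion.\<close>
lemma nn_integral_S_kernel_eq_euler_kernel:
  "(\<integral>\<^sup>+t. \<integral>\<^sup>+v. \<integral>\<^sup>+u. ennreal (S_kernel n p q s t v u) \<partial>unit_lborel \<partial>unit_lborel \<partial>unit_lborel) =
   (\<integral>\<^sup>+y. \<integral>\<^sup>+x. \<integral>\<^sup>+w. ennreal (euler_kernel p q (n + s) (n + s + 1) (s + 1) (2 * n + 2 * s + 2) x y w)
      \<partial>unit_lborel \<partial>unit_lborel \<partial>unit_lborel)"
proof -
  define E where "E = euler_kernel p q (n + s) (n + s + 1) (s + 1) (2 * n + 2 * s + 2)"
  define D where "D = (\<lambda>k w :: real. (1 - k) / (1 - k * w)\<^sup>2)"
  define m where "m = (\<lambda>w v u. D (u + v - u * v) w * S_kernel n p q s (1 - moebius (u + v - u * v) w) v u)"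
  have D_nn: "D k w \<ge> 0" if "k \<le> 1" for k w using that by (simp add: D_def)
  have k_lt: "u + v - u * v < 1" if "u < 1" "v < 1" for u v :: real
  proof -
    have "(1 - u) * (1 - v) > 0" using that by simp
    then show ?thesis by (simp add: algebra_simps)
  qed
  have m_eq: "m w v u = D w v * (D w u * E (moebius w u) (moebius w v) w)"
    if "u \<in> {0<..<1}" "v \<in> {0<..<1}" "w \<in> {0<..<1}" for u v w
    using moebius_kernel_identity[OF that, of p q n s] by (simp add: m_def D_def E_def)
  have m_meas: "(\<lambda>(w, v, u). ennreal (m w v u)) \<in> borel_measurable (borel \<Otimes>\<^sub>M borel \<Otimes>\<^sub>M borel)"
    unfolding m_def D_def S_kernel_def moebius_def by measurable
  have inner: "(\<integral>\<^sup>+y. \<integral>\<^sup>+x. ennreal (E x y w) \<partial>unit_lborel \<partial>unit_lborel) =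
      (\<integral>\<^sup>+v. \<integral>\<^sup>+u. ennreal (m w v u) \<partial>unit_lborel \<partial>unit_lborel)" if w: "w \<in> {0<..<1}" for w
  proof -
    have w1: "w < 1" using w by simp
    have "(\<integral>\<^sup>+y. \<integral>\<^sup>+x. ennreal (E x y w) \<partial>unit_lborel \<partial>unit_lborel) =
       (\<integral>\<^sup>+v. ennreal (D w v) * (\<integral>\<^sup>+x. ennreal (E x (moebius w v) w) \<partial>unit_lborel) \<partial>unit_lborel)"
      unfolding D_def
    proof (rule nn_integral_moebius[OF w1])
      have "(\<lambda>(y, x). ennreal (E x y w)) \<in> borel_measurable (unit_lborel \<Otimes>\<^sub>M unit_lborel)"
        unfolding E_def euler_kernel_def by (intro measurable_unit_lborel_pairI) measurable
      then show "(\<lambda>y. \<integral>\<^sup>+x. ennreal (E x y w) \<partial>unit_lborel) \<in> borel_measurable unit_lborel"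
        by (rule unit_lborel.borel_measurable_nn_integral)
    qed
    also have "\<dots> = (\<integral>\<^sup>+v. ennreal (D w v) * (\<integral>\<^sup>+u. ennreal (D w u) * ennreal (E (moebius w u) (moebius w v) w) \<partial>unit_lborel) \<partial>unit_lborel)"
      unfolding D_def
      by (intro nn_integral_cong arg_cong2[where f = "(*)"] refl nn_integral_moebius[OF w1] measurable_unit_lborelI)
        (unfold E_def euler_kernel_def, measurable)
    also have "\<dots> = (\<integral>\<^sup>+v. \<integral>\<^sup>+u. ennreal (D w v) * (ennreal (D w u) * ennreal (E (moebius w u) (moebius w v) w)) \<partial>unit_lborel \<partial>unit_lborel)"
      by (intro nn_integral_cong nn_integral_cmult[symmetric] measurable_unit_lborelI)
        (unfold E_def D_def moebius_def euler_kernel_def, measurable)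
    also have "\<dots> = (\<integral>\<^sup>+v. \<integral>\<^sup>+u. ennreal (m w v u) \<partial>unit_lborel \<partial>unit_lborel)"
      using w D_nn[of w] 
      by (intro nn_integral_cong) (simp add: m_eq E_def euler_kernel_nonneg flip: ennreal_mult)
    finally show ?thesis .
  qed
  have "(\<integral>\<^sup>+y. \<integral>\<^sup>+x. \<integral>\<^sup>+w. ennreal (E x y w) \<partial>unit_lborel \<partial>unit_lborel \<partial>unit_lborel) =
    (\<integral>\<^sup>+w. \<integral>\<^sup>+y. \<integral>\<^sup>+x. ennreal (E x y w) \<partial>unit_lborel \<partial>unit_lborel \<partial>unit_lborel)"
    by (rule nn_integral_unit_lborel_rotate) (unfold E_def euler_kernel_def, measurable)
  also have "\<dots> = (\<integral>\<^sup>+w. \<integral>\<^sup>+v. \<integral>\<^sup>+u. ennreal (m w v u) \<partial>unit_lborel \<partial>unit_lborel \<partial>unit_lborel)"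
    by (rule nn_integral_cong) (simp add: inner)
  also have "\<dots> = (\<integral>\<^sup>+u. \<integral>\<^sup>+w. \<integral>\<^sup>+v. ennreal (m w v u) \<partial>unit_lborel \<partial>unit_lborel \<partial>unit_lborel)"
    by (rule nn_integral_unit_lborel_rotate) (rule m_meas)
  also have "\<dots> = (\<integral>\<^sup>+v. \<integral>\<^sup>+u. \<integral>\<^sup>+w. ennreal (m w v u) \<partial>unit_lborel \<partial>unit_lborel \<partial>unit_lborel)"
    by (rule nn_integral_unit_lborel_rotate)
      (unfold m_def D_def S_kernel_def moebius_def, measurable)
  also have "\<dots> = (\<integral>\<^sup>+v. \<integral>\<^sup>+u. \<integral>\<^sup>+t. ennreal (S_kernel n p q s t v u) \<partial>unit_lborel \<partial>unit_lborel \<partial>unit_lborel)"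
  proof (rule nn_integral_cong, rule nn_integral_cong)
    fix v u assume "v \<in> space unit_lborel" "u \<in> space unit_lborel"
    then have k: "u + v - u * v < 1" using k_lt by simp
    have "(\<integral>\<^sup>+w. ennreal (m w v u) \<partial>unit_lborel) =
      (\<integral>\<^sup>+w. ennreal (D (u + v - u * v) w) * ennreal (S_kernel n p q s (1 - moebius (u + v - u * v) w) v u) \<partial>unit_lborel)"
      unfolding m_def using D_nn k by (intro nn_integral_cong ennreal_mult') simp
    also have "\<dots> = (\<integral>\<^sup>+r. ennreal (S_kernel n p q s (1 - r) v u) \<partial>unit_lborel)"
      unfolding D_def
      by (rule nn_integral_moebius[OF k, symmetric], rule measurable_unit_lborelI)
        (unfold S_kernel_def, measurable)
    also have "\<dots> = (\<integral>\<^sup>+t. ennreal (S_kernel n p q s t v u) \<partial>unit_lborel)"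
      by (rule nn_integral_unit_lborel_reflect[symmetric]) (unfold S_kernel_def, measurable)
    finally show "(\<integral>\<^sup>+w. ennreal (m w v u) \<partial>unit_lborel) = (\<integral>\<^sup>+t. ennreal (S_kernel n p q s t v u) \<partial>unit_lborel)" .
  qed
  also have "\<dots> = (\<integral>\<^sup>+t. \<integral>\<^sup>+v. \<integral>\<^sup>+u. ennreal (S_kernel n p q s t v u) \<partial>unit_lborel \<partial>unit_lborel \<partial>unit_lborel)"
    by (rule nn_integral_unit_lborel_rotate) (unfold S_kernel_def, measurable)
  finally show ?thesis by (simp add: E_def)
qed

lemma S_kernel_nonneg: "S_kernel n p q s t v u \<ge> 0"
  by (simp add: S_kernel_def)

lemma S_kernel_measurable:
  "(\<lambda>(t, v, u). S_kernel n p q s t v u) \<in> borel_measurable (borel \<Otimes>\<^sub>M borel \<Otimes>\<^sub>M borel)"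
  unfolding S_kernel_def by measurable

text \<open>For \<open>s > -1\<close> the integral over \<open>(x,y,w)\<close> is finite, hence so is the one over \<open>(t,v,u)\<close>,
  and the identity of nonnegative integrals passes to Lebesgue integrals.\<close>
lemma LINT_S_kernel_eq_euler_kernel:
  fixes n p q s :: real
  assumes "p > 0" "q > 0" "n > 0" "s > -1"
  shows "(LINT t|unit_lborel. LINT v|unit_lborel. LINT u|unit_lborel. S_kernel n p q s t v u) =
    (LINT (y, x, w)|(unit_lborel \<Otimes>\<^sub>M unit_lborel \<Otimes>\<^sub>M unit_lborel).
       euler_kernel p q (n + s) (n + s + 1) (s + 1) (2 * n + 2 * s + 2) x y w)"
    (is "_ = (LINT (y, x, w)|?M. ?E x y w)")
proof -
  have eq: "(\<integral>\<^sup>+(t, v, u). ennreal (S_kernel n p q s t v u) \<partial>?M) = (\<integral>\<^sup>+(y, x, w). ennreal (?E x y w) \<partial>?M)"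
    using nn_integral_S_kernel_eq_euler_kernel[of n p q s]
    by (subst (1 2) nn_integral_unit_lborel_triple[symmetric])
      (auto simp: S_kernel_def euler_kernel_def)
  have int: "integrable ?M (\<lambda>(y, x, w). ?E x y w)"
    using assms by (intro euler_kernel_integrable) auto
  have E_nn: "(\<integral>\<^sup>+(y, x, w). ennreal (?E x y w) \<partial>?M) = ennreal (LINT (y, x, w)|?M. ?E x y w)"
    using nn_integral_eq_integral[OF int] by (simp add: euler_kernel_nonneg case_prod_unfold)
  have meas: "(\<lambda>(t, v, u). S_kernel n p q s t v u) \<in> borel_measurable ?M"
    by (intro measurable_unit_lborel_tripleI S_kernel_measurable)
  have int': "integrable ?M (\<lambda>(t, v, u). S_kernel n p q s t v u)"
    by (rule integrableI_nonneg[OF meas])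
      (use eq E_nn in \<open>auto simp: S_kernel_nonneg case_prod_unfold\<close>)
  have "ennreal (LINT (t, v, u)|?M. S_kernel n p q s t v u) = ennreal (LINT (y, x, w)|?M. ?E x y w)"
    using nn_integral_eq_integral[OF int'] eq E_nn
    by (simp add: S_kernel_nonneg case_prod_unfold)
  then have "(LINT (t, v, u)|?M. S_kernel n p q s t v u) = (LINT (y, x, w)|?M. ?E x y w)"
    by (subst (asm) ennreal_inj)
      (auto intro!: integral_nonneg_AE simp: S_kernel_nonneg euler_kernel_nonneg case_prod_unfold)
  then show ?thesis
    using LINT_unit_lborel_triple[OF int' S_kernel_measurable] by simp
qed

section \<open>The left-hand side as a triple integral\<close>

lemma S_fun_commute: "S_fun n p q t = S_fun n q p t"
  by (simp add: S_fun_def hyp2F1_commute[of "real p"] add.commute[of p])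

text \<open>The normalisation by the value at \<open>1\<close> cancels the Beta factor of Euler's integral and leaves
  \<open>1 / B(p,n)\<close>.\<close>
lemma S_fun_eq_integral:
  assumes "n \<ge> 1" "p \<ge> 1" "q \<ge> 1" "0 < t" "t < 1"
  shows "S_fun n p q t = pochhammer (real p) n / Gamma (real n) *
    (LINT u|unit_lborel. u powr (real p - 1) * (1 - u) powr (real q + real n - 1) * (1 - t * u) powr (- real q))"
proof -
  let ?c = "real (p + q + n)"
  have c: "?c - real p = real q + real n" "?c - real q - real p = real n" by simp_all
  have pos: "real p > 0" "real n > 0" "real q > 0" using assms by auto
  have E: "(LINT u|unit_lborel. u powr (real p - 1) * (1 - u) powr (real q + real n - 1) * (1 - t * u) powr (- real q))
      = Beta (real p) (real q + real n) * hyp2F1 (real p) (real q) ?c t"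
    using Euler_integral_hyp2F1[of "real p" ?c t "real q"] assms pos
    unfolding c by (simp add: has_bochner_integral_integral_eq hyp2F1_commute[of "real q"])
  have G: "Beta (real p) (real q + real n) * hyp2F1 (real p) (real q) ?c 1 = Beta (real p) (real n)"
    using Gauss_hyp2F1_1[of "real q" "real p" ?c] pos unfolding c
    by (simp add: hyp2F1_commute[of "real q"])
  have "real p \<notin> \<int>\<^sub>\<le>\<^sub>0" using pos by (auto dest: nonpos_Ints_nonpos)
  then have P: "pochhammer (real p) n / Gamma (real n) = 1 / Beta (real p) (real n)"
    by (simp add: pochhammer_Gamma Beta_def)
  have B: "Beta (real p) (real q + real n) > 0" using pos by (simp add: Beta_def)
  have "S_fun n p q t = (Beta (real p) (real q + real n) * hyp2F1 (real p) (real q) ?c t) /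
    (Beta (real p) (real q + real n) * hyp2F1 (real p) (real q) ?c 1)"
    using B by (simp add: S_fun_def)
  then show ?thesis unfolding G P E by simp
qed

lemma c_integral_eq_euler_kernel:
  assumes "n \<ge> 1" "p \<ge> 1" "q \<ge> 1" "s > -1"
  shows "c_integral n p q s = pochhammer (s + 1) n *
    (pochhammer (real p) n * pochhammer (real q) n / Gamma (real n) ^ 3) *
    (LINT (y, x, w)|(unit_lborel \<Otimes>\<^sub>M unit_lborel \<Otimes>\<^sub>M unit_lborel).
       euler_kernel (real p) (real q) (real n + s) (real n + s + 1) (s + 1) (2 * real n + 2 * s + 2) x y w)"
proof -
  define a where "a = pochhammer (real p) n / Gamma (real n)"
  define b where "b = pochhammer (real q) n / Gamma (real n)"
  have "t ^ (p + q + n - 1) * (1 - t) powr s * (S_fun n p q t)\<^sup>2 =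
    a * b * (LINT v|unit_lborel. LINT u|unit_lborel. S_kernel (real n) (real p) (real q) s t v u)"
    if t: "t \<in> {0<..<1}" for t
  proof -
    have pw: "t powr (real p + real q + real n - 1) = t ^ (p + q + n - 1)"
      using t assms by (simp add: powr_realpow[symmetric] of_nat_diff)
    have S: "(S_fun n p q t)\<^sup>2 = S_fun n p q t * S_fun n q p t"
      by (simp add: S_fun_commute[of n q p] power2_eq_square)
    define f where "f = (\<lambda>u. u powr (real p - 1) * (1 - u) powr (real q + real n - 1) * (1 - t * u) powr (- real q))"
    define g where "g = (\<lambda>v. v powr (real q - 1) * (1 - v) powr (real p + real n - 1) * (1 - t * v) powr (- real p))"
    have "(LINT v|unit_lborel. LINT u|unit_lborel. S_kernel (real n) (real p) (real q) s t v u) =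
      (LINT v|unit_lborel. LINT u|unit_lborel. t ^ (p + q + n - 1) * (1 - t) powr s * g v * f u)"
      by (simp add: S_kernel_def pw f_def g_def mult_ac)
    also have "\<dots> = t ^ (p + q + n - 1) * (1 - t) powr s * (LINT v|unit_lborel. g v) * (LINT u|unit_lborel. f u)"
      by simp
    finally show ?thesis
      using t assms unfolding S
      by (simp add: a_def b_def S_fun_eq_integral f_def g_def)
  qed
  then have "(LINT t|unit_lborel. t ^ (p + q + n - 1) * (1 - t) powr s * (S_fun n p q t)\<^sup>2) =
    a * b * (LINT t|unit_lborel. LINT v|unit_lborel. LINT u|unit_lborel. S_kernel (real n) (real p) (real q) s t v u)"
    by (subst integral_mult_right_zero[symmetric]) (intro Bochner_Integration.integral_cong refl, simp)
  then show ?thesis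
    using assms unfolding c_integral_def LBINT_eq_unit_lborel
    by (simp add: LINT_S_kernel_eq_euler_kernel a_def b_def power3_eq_cube)
qed

section \<open>The integral representation of the continued coefficients\<close>

theorem theorem3:
  fixes n p q :: nat and s :: real
  assumes "n \<ge> 1" and "p \<ge> 1" and "q \<ge> 1" and "s > - real n - 1"
  shows "c_fun n p q (complex_of_real s) = complex_of_real
    (Gamma (s + real n + 1) * Gamma (s + 1 + 2 * real n) /
       (Gamma (real n) ^ 3 * Gamma (2 * s + 2 * real n + 2)) *
     (pochhammer (real p) n * pochhammer (real q) n) *
     (LBINT y=0..1. (LBINT x=0..1.
        x ^ (p - 1) * y ^ (q - 1) * (1 - x) powr (real n + s) * (1 - y) powr (real n + s) *
        hyp2F1 (s + 1) (real n + s + 1) (2 * real n + 2 * s + 2) (1 - x * y))))"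
proof -
  let ?M = "unit_lborel \<Otimes>\<^sub>M unit_lborel \<Otimes>\<^sub>M unit_lborel"
  define R where "R = (\<lambda>s. LBINT y=0..1. (LBINT x=0..1.
        x ^ (p - 1) * y ^ (q - 1) * (1 - x) powr (real n + s) * (1 - y) powr (real n + s) *
        hyp2F1 (s + 1) (real n + s + 1) (2 * real n + 2 * s + 2) (1 - x * y)))"
  define P where "P = pochhammer (real p) n * pochhammer (real q) n / Gamma (real n) ^ 3"
  define rhs where "rhs = (\<lambda>s. P * (Gamma (s + real n + 1) * Gamma (s + 1 + 2 * real n) / Gamma (2 * s + 2 * real n + 2)) * R s)"
  have pos: "real n > 0" "real p > 0" "real q > 0" using assms by auto
  have R_eq: "R s = (LINT y|unit_lborel. LINT x|unit_lborel.
      x powr (real p - 1) * y powr (real q - 1) * (1 - x) powr (real n + s) * (1 - y) powr (real n + s) *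
      hyp2F1 (s + 1) (real n + s + 1) (2 * real n + 2 * s + 2) (1 - x * y))" for s
    unfolding R_def LBINT_eq_unit_lborel
    using assms by (intro Bochner_Integration.integral_cong refl) (simp add: powr_realpow[symmetric] of_nat_diff)
  obtain F where F_hol: "F holomorphic_on {z. Re z > - real n - 1}"
    and F: "\<And>s. s > - real n - 1 \<Longrightarrow> F (complex_of_real s) = complex_of_real (LINT (y, x, w)|?M.
         euler_kernel (real p) (real q) (real n + s) (s + 1) (real n + s + 1) (2 * real n + 2 * s + 2) x y w)"
    using holomorphic_euler_kernel[OF assms(1-3)] by metis
  define G where "G = (\<lambda>z. of_real P * pochhammer (z + of_nat n + 1) n * F z)"
  \<comment> \<open>Euler's integral with \<open>b = n + s + 1\<close>: valid on the whole half-line.\<close>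
  have G_real: "G (complex_of_real s) = complex_of_real (rhs s)" if s: "s > - real n - 1" for s
  proof -
    have cb: "2 * real n + 2 * s + 2 - (real n + s + 1) = real n + s + 1" by simp
    have "Beta (real n + s + 1) (real n + s + 1) * R s = (LINT (y, x, w)|?M.
         euler_kernel (real p) (real q) (real n + s) (s + 1) (real n + s + 1) (2 * real n + 2 * s + 2) x y w)"
      using LINT_hyp2F1_eq_euler_kernel[of "real p" "real q" "real n + s" "real n + s + 1" "2 * real n + 2 * s + 2" "s + 1"]
        pos s unfolding cb by (simp add: R_eq)
    then have "F (complex_of_real s) = complex_of_real (Beta (real n + s + 1) (real n + s + 1) * R s)"
      by (simp add: F[OF s])
    moreover have "pochhammer (complex_of_real s + of_nat n + 1) n = complex_of_real (pochhammer (s + real n + 1) n)"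
      by (simp add: pochhammer_of_real[symmetric])
    ultimately have "G (complex_of_real s) = complex_of_real (P * pochhammer (s + real n + 1) n * (Beta (real n + s + 1) (real n + s + 1) * R s))"
      by (simp add: G_def)
    moreover have "s + real n + 1 \<notin> \<int>\<^sub>\<le>\<^sub>0" using s by (auto dest: nonpos_Ints_nonpos)
    moreover have "Gamma (s + real n + 1) > 0" using s by simp
    ultimately show ?thesis
      by (simp add: rhs_def pochhammer_Gamma Beta_def add_ac)
  qed
  \<comment> \<open>Euler's integral with \<open>b = s + 1\<close>: valid only for \<open>s > -1\<close>, but directly comparable with
    the definition of \<open>c_pq(s)\<close>.\<close>
  have c_rhs: "c_integral n p q s = rhs s" if s: "s > -1" for s
  proof -
    have cb: "2 * real n + 2 * s + 2 - (s + 1) = 2 * real n + s + 1" by simp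
    have "Beta (s + 1) (2 * real n + s + 1) * R s = (LINT (y, x, w)|?M.
         euler_kernel (real p) (real q) (real n + s) (real n + s + 1) (s + 1) (2 * real n + 2 * s + 2) x y w)"
      using LINT_hyp2F1_eq_euler_kernel[of "real p" "real q" "real n + s" "s + 1" "2 * real n + 2 * s + 2" "real n + s + 1"]
        pos s unfolding cb by (simp add: R_eq hyp2F1_commute[of "real n + s + 1"])
    then have "c_integral n p q s = pochhammer (s + 1) n * P * (Beta (s + 1) (2 * real n + s + 1) * R s)"
      unfolding c_integral_eq_euler_kernel[OF assms(1-3) s] P_def by simp
    moreover have "s + 1 \<notin> \<int>\<^sub>\<le>\<^sub>0" using s by (auto dest: nonpos_Ints_nonpos)
    moreover have "Gamma (s + 1) > 0" using s by simp
    ultimately show ?thesis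
      by (simp add: rhs_def pochhammer_Gamma Beta_def add_ac)
  qed
  have G: "c_extension n p q G"
    unfolding c_extension_def
  proof (intro conjI allI impI)
    show "G holomorphic_on {z. Re z > - real n - 1}"
      unfolding G_def by (intro holomorphic_intros F_hol)
    fix s :: real assume "s > -1"
    then show "G (complex_of_real s) = complex_of_real (c_integral n p q s)"
      using c_rhs G_real by simp
  qed
  then have "c_extension n p q (c_fun n p q)"
    unfolding c_fun_def by (rule someI[of "c_extension n p q"])
  then have "c_fun n p q (complex_of_real s) = G (complex_of_real s)"
    using G assms(4) by (intro c_extension_unique) auto
  then show ?thesis
    using G_real[OF assms(4)] by (simp add: rhs_def P_def R_def)
qed

end
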